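(* Let $r\in\mathbb{R}^m_{++}$, $c\in\mathbb{R}^n_{++}$ have equal total mass one, let $C\in\mathbb{R}^{m\times n}$, $\eta>0$, $K=\exp(-C/\eta)$ (entrywise). Let $(u^k,v^k,X^{k+1})_{k\ge0}$ be the BDRS iterates and let $a^k=\bigodot_{t=0}^k u^t$, $b^k=\bigodot_{t=0}^k v^t$ be the cumulative scaling vectors. Then the BDRS iterations can be completely decoupled from the intermediate matrix $X^k$: with initial conditions $a^{-1}=\mathbf{1}_m$, $b^{-1}=b^{-2}=\mathbf{1}_n$, for every $k\ge 0$, $$a^k=\frac{r}{K^{\odot(k+1)}\left[\dfrac{(b^{k-1})^{\odot 2}}{b^{k-2}}\right]},\qquad b^k=\frac{c}{(K^{\odot(k+1)})^\top a^k},\qquad X^{k+1}=\operatorname{diag}(a^k)\,K^{\odot(k+1)}\operatorname{diag}(b^k).$$ That is, the recursion above in the vectors $a,b$ alone generates exactly the cumulative scalings of BDRS, and the displayed formula for $X^{k+1}$ gives exactly the BDRS matrix.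
   Context: Notation: $\odot$ is the entrywise product, $M^{\odot p}$ the entrywise $p$-th power, fractions of vectors are entrywise quotients, $\exp$ of a matrix is entrywise, $\mathbf{1}$ denotes all-ones vectors or matrices. BDRS (Bregman Douglas--Rachford splitting for unregularized optimal transport) is the iteration, initialized with $u^{-1}=\mathbf{1}_m$, $v^{-1}=\mathbf{1}_n$, $X^0=\mathbf{1}_{m\times n}$, and for $k=0,1,2,\dots$ $$u^k=\frac{r}{(X^k\odot K)v^{k-1}},\qquad v^k=\frac{c}{(X^k\odot K)^\top u^k},\qquad X^{k+1}=\operatorname{diag}(u^k)(X^k\odot K)\operatorname{diag}(v^k).$$ *)

theory Defs
  imports "HOL-Analysis.Analysis"
begin

text \<open>
  The library's ring operations on \<^typ>\<open>'a ^ 'n\<close>, and hence on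
  \<^typ>\<open>'a ^ 'n ^ 'm\<close>, are componentwise: for vectors and for matrices, \<open>*\<close> is the
  entrywise product, \<open>^\<close> is the entrywise power, \<open>\<Prod>\<close> is the entrywise product over an
  index set and \<open>1\<close> is the all-ones vector or matrix. Matrix products are written
  \<open>**\<close> and \<open>*v\<close>.
\<close>

definition vec_divide :: "real ^ 'n \<Rightarrow> real ^ 'n \<Rightarrow> real ^ 'n"  (infixl "\<oslash>" 70)
  where "x \<oslash> y = (\<chi> i. x $ i / y $ i)"

definition diag_mat :: "real ^ 'n \<Rightarrow> real ^ 'n ^ 'n"
  where "diag_mat x = (\<chi> i j. if i = j then x $ i else 0)"

definition gibbs_kernel :: "real ^ 'n ^ 'm \<Rightarrow> real \<Rightarrow> real ^ 'n ^ 'm"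
  where "gibbs_kernel C \<eta> = (\<chi> i j. exp (- (C $ i $ j) / \<eta>))"

text \<open>
  The scaling vectors are indexed by integers because the iteration starts at index \<open>-1\<close>;
  values at smaller indices are unconstrained. When \<open>r\<close>, \<open>c\<close> and \<open>K\<close> are entrywise positive,
  as below, all divisors here and in \<open>decoupled_recursion\<close> are entrywise positive, so the
  convention \<open>x / 0 = 0\<close> plays no role.
\<close>

definition bdrs_iterates ::
  "real ^ 'm \<Rightarrow> real ^ 'n \<Rightarrow> real ^ 'n ^ 'm \<Rightarrow>
   (int \<Rightarrow> real ^ 'm) \<Rightarrow> (int \<Rightarrow> real ^ 'n) \<Rightarrow> (nat \<Rightarrow> real ^ 'n ^ 'm) \<Rightarrow> bool"
  where "bdrs_iterates r c K u v X \<longleftrightarrow>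
    u (- 1) = 1 \<and> v (- 1) = 1 \<and> X 0 = 1 \<and>
    (\<forall>k. u (int k) = r \<oslash> ((X k * K) *v v (int k - 1)) \<and>
         v (int k) = c \<oslash> (transpose (X k * K) *v u (int k)) \<and>
         X (k + 1) = diag_mat (u (int k)) ** (X k * K) ** diag_mat (v (int k)))"

text \<open>For \<open>k < 0\<close> this is the empty product, the all-ones vector.\<close>

definition cumulative_scaling :: "(int \<Rightarrow> real ^ 'n) \<Rightarrow> int \<Rightarrow> real ^ 'n"
  where "cumulative_scaling u k = (\<Prod>t\<in>{0..k}. u t)"

definition decoupled_recursion ::
  "real ^ 'm \<Rightarrow> real ^ 'n \<Rightarrow> real ^ 'n ^ 'm \<Rightarrow> (int \<Rightarrow> real ^ 'm) \<Rightarrow> (int \<Rightarrow> real ^ 'n) \<Rightarrow> bool"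
  where "decoupled_recursion r c K a b \<longleftrightarrow>
    a (- 1) = 1 \<and> b (- 1) = 1 \<and> b (- 2) = 1 \<and>
    (\<forall>k. a (int k) = r \<oslash> (K ^ (k + 1) *v ((b (int k - 1)) ^ 2 \<oslash> b (int k - 2))) \<and>
         b (int k) = c \<oslash> (transpose (K ^ (k + 1)) *v a (int k)))"

end

theory Submission
  imports Defs
begin

text \<open>
  The matrix \<open>X\<^sup>k\<close> is the diagonal scaling of the entrywise power \<open>K\<^sup>k\<close> by the cumulative vectors \<open>a\<^sup>k\<^sup>-\<^sup>1\<close>
  and \<open>b\<^sup>k\<^sup>-\<^sup>1\<close>. In the update of \<open>u\<^sup>k\<close> the row factor \<open>a\<^sup>k\<^sup>-\<^sup>1\<close> therefore pulls out of the matrix-vector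
  product, and multiplying by it turns \<open>u\<^sup>k\<close> into \<open>a\<^sup>k\<close>; the remaining factor
  \<open>b\<^sup>k\<^sup>-\<^sup>1 v\<^sup>k\<^sup>-\<^sup>1\<close> is \<open>(b\<^sup>k\<^sup>-\<^sup>1)\<^sup>2 / b\<^sup>k\<^sup>-\<^sup>2\<close>. The update of \<open>v\<^sup>k\<close> is treated in the same way. All
  divisions are legitimate because the iterates stay entrywise positive.
\<close>

lemma power_vec_nth [simp]: "(x ^ n) $ i = (x $ i) ^ n"
  for x :: "'a::comm_semiring_1 ^ 'n"
  by (induction n) auto

lemma vec_divide_nth [simp]: "(x \<oslash> y) $ i = x $ i / y $ i"
  by (simp add: vec_divide_def)

lemma diag_mat_scaling_nth [simp]:
  fixes M :: "real ^ 'm ^ 'n"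
  shows "(diag_mat x ** M ** diag_mat y) $ i $ j = x $ i * M $ i $ j * y $ j"
proof -
  \<comment> \<open>Moving the product inside the conditional leaves a sum with a single nonzero
    term.\<close>
  have "(diag_mat x ** N) $ i $ l = x $ i * N $ i $ l" for N :: "real ^ 'm ^ 'n" and l
    by (simp add: matrix_matrix_mult_def diag_mat_def if_distrib[of "\<lambda>z. z * _"] cong: if_cong)
  moreover have "(N ** diag_mat y) $ i $ j = N $ i $ j * y $ j" for N :: "real ^ 'm ^ 'n"
    by (simp add: matrix_matrix_mult_def diag_mat_def if_distrib[of "\<lambda>z. _ * z"] cong: if_cong)
  ultimately show ?thesis
    by simp
qed

lemma matrix_vector_mult_pos:
  fixes M :: "real ^ 'n ^ 'm"
  assumes "\<And>i j. 0 < M $ i $ j" and "\<And>j. 0 < x $ j"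
  shows "0 < (M *v x) $ i"
  unfolding matrix_vector_mult_def using assms by (auto intro!: sum_pos)

lemma cumulative_scaling_step:
  "cumulative_scaling u (int k) = cumulative_scaling u (int k - 1) * u (int k)"
proof -
  have "{0..int k} = insert (int k) {0..int k - 1}"
    by auto
  then show ?thesis
    by (simp add: cumulative_scaling_def mult.commute)
qed

lemma cumulative_scaling_neg: "k < 0 \<Longrightarrow> cumulative_scaling u k = 1"
  by (simp add: cumulative_scaling_def)

lemma cumulative_scaling_pos:
  assumes "\<And>t i. 0 < u (int t) $ i"
  shows "0 < cumulative_scaling u k $ i"
proof -
  have "cumulative_scaling u k $ i = (\<Prod>t\<in>{0..k}. u t $ i)"
    unfolding cumulative_scaling_def
    by (induction rule: infinite_finite_induct) simp_all
  moreover have "0 < u t $ i" if "t \<in> {0..k}" for t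
    using that assms[of "nat t"] by simp
  ultimately show ?thesis
    by (auto intro: prod_pos)
qed

text \<open>Each update divides a positive vector by the product of a positive matrix and a positive
  vector, so positivity propagates. This supplies the nonzero divisors for all later
  cancellations.\<close>

lemma bdrs_iterates_pos:
  assumes "\<And>i. 0 < r $ i" and "\<And>j. 0 < c $ j" and K: "\<And>i j. 0 < K $ i $ j"
    and "bdrs_iterates r c K u v X"
  shows "0 < u (int k) $ i" and "0 < v (int k) $ j"
proof -
  have u: "u (int k) = r \<oslash> ((X k * K) *v v (int k - 1))"
    and v: "v (int k) = c \<oslash> (transpose (X k * K) *v u (int k))"
    and X: "X (Suc k) = diag_mat (u (int k)) ** (X k * K) ** diag_mat (v (int k))" for k
    using assms(4) by (auto simp: bdrs_iterates_def)
  have u_pos: "0 < u (int k) $ i"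
    if "\<And>i j. 0 < X k $ i $ j" and "\<And>j. 0 < v (int k - 1) $ j" for k i
    unfolding u using that K assms(1) by (auto intro!: divide_pos_pos matrix_vector_mult_pos)
  have v_pos: "0 < v (int k) $ j"
    if "\<And>i j. 0 < X k $ i $ j" and "\<And>i. 0 < u (int k) $ i" for k j
    unfolding v using that K assms(2)
    by (auto intro!: divide_pos_pos matrix_vector_mult_pos simp: transpose_def)
  \<comment> \<open>\<open>X k\<close> and \<open>v (int k - 1)\<close> are exactly the data from
    which step \<open>k\<close> starts.\<close>
  have invariant: "(\<forall>i j. 0 < X k $ i $ j) \<and> (\<forall>j. 0 < v (int k - 1) $ j)" for k
  proof (induction k)
    case 0
    then show ?case
      using assms(4) by (simp add: bdrs_iterates_def)
  next
    case (Suc k)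
    then have "\<forall>i. 0 < u (int k) $ i"
      using u_pos by blast
    moreover from this Suc have "\<forall>j. 0 < v (int k) $ j"
      using v_pos by blast
    ultimately show ?case
      using Suc K by (simp add: X)
  qed
  show "0 < u (int k) $ i" for i
    using invariant u_pos by blast
  then show "0 < v (int k) $ j"
    using invariant v_pos by blast
qed

text \<open>Row and column scalings commute with the entrywise product by \<open>K\<close>, so the
  factors of successive steps accumulate. At \<open>k = 0\<close> both scalings are empty products
  and \<open>K ^ 0\<close> is the all-ones matrix.\<close>

lemma bdrs_matrix_eq:
  assumes "bdrs_iterates r c K u v X"
  shows "X k = diag_mat (cumulative_scaling u (int k - 1)) ** K ^ k **
    diag_mat (cumulative_scaling v (int k - 1))"
proof (induction k)
  case 0
  then show ?case
    using assms by (simp add: bdrs_iterates_def vec_eq_iff cumulative_scaling_neg)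
next
  case (Suc k)
  have "X (Suc k) = diag_mat (u (int k)) ** (X k * K) ** diag_mat (v (int k))"
    using assms by (simp add: bdrs_iterates_def)
  then show ?case
    by (simp add: Suc.IH cumulative_scaling_step vec_eq_iff algebra_simps)
qed

text \<open>Needed for the converse direction: running the recursion alone must reproduce the
  cumulative scalings.\<close>

lemma decoupled_recursion_unique:
  assumes "decoupled_recursion r c K a b" and "decoupled_recursion r c K a' b'"
  shows "a' (int k) = a (int k)" and "b' (int k) = b (int k)"
proof -
  have step: "a' (int k) = a (int k) \<and> b' (int k) = b (int k)"
    if "b' (int k - 1) = b (int k - 1)" and "b' (int k - 2) = b (int k - 2)" for k
    using assms that by (simp add: decoupled_recursion_def)
  \<comment> \<open>The recursion has order two in \<open>b\<close>, so the induction carries two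
    consecutive values; the base case is the pair of initial conditions.\<close>
  have "b' (int k - 1) = b (int k - 1) \<and> b' (int k - 2) = b (int k - 2)" for k
  proof (induction k)
    case 0
    then show ?case
      using assms by (simp add: decoupled_recursion_def)
  next
    case (Suc k)
    then show ?case
      using step by simp
  qed
  then show "a' (int k) = a (int k)" and "b' (int k) = b (int k)"
    using step by blast+
qed

lemma bdrs_decoupled:
  assumes r: "\<And>i. 0 < r $ i" and c: "\<And>j. 0 < c $ j" and K: "\<And>i j. 0 < K $ i $ j"
    and bdrs: "bdrs_iterates r c K u v X"
  shows "decoupled_recursion r c K (cumulative_scaling u) (cumulative_scaling v)"
proof -
  define a where "a = cumulative_scaling u"
  define b where "b = cumulative_scaling v"
  have a_nz: "a k $ i \<noteq> 0" and b_nz: "b k $ j \<noteq> 0" for k i j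
    using cumulative_scaling_pos bdrs_iterates_pos[OF r c K bdrs]
    by (metis a_def less_irrefl, metis b_def less_irrefl)
  have X: "X k $ i $ j = a (int k - 1) $ i * K $ i $ j ^ k * b (int k - 1) $ j" for k i j
    unfolding a_def b_def by (subst bdrs_matrix_eq[OF bdrs]) simp
  \<comment> \<open>A ratio of consecutive cumulative products. The case \<open>k = 0\<close> is
    separate: \<open>v (- 1)\<close> is not a factor of any \<open>b\<close>, but both sides are
    1.\<close>
  have v_prev: "v (int k - 1) $ j = b (int k - 1) $ j / b (int k - 2) $ j" for k j
  proof (cases k)
    case 0
    then show ?thesis
      using bdrs by (simp add: b_def cumulative_scaling_neg bdrs_iterates_def)
  next
    case (Suc n)
    then have "b (int k - 1) = b (int k - 2) * v (int k - 1)"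
      using cumulative_scaling_step[of v n] by (simp add: b_def)
    then show ?thesis
      using b_nz[of "int k - 2" j] by simp
  qed
  have "a (int k) = r \<oslash> (K ^ (k + 1) *v ((b (int k - 1)) ^ 2 \<oslash> b (int k - 2)))" for k
  proof -
    have "((X k * K) *v v (int k - 1)) $ i =
        a (int k - 1) $ i * (K ^ (k + 1) *v ((b (int k - 1)) ^ 2 \<oslash> b (int k - 2))) $ i" for i
      by (simp add: matrix_vector_mult_def X v_prev sum_distrib_left power2_eq_square mult_ac)
    moreover have "u (int k) = r \<oslash> ((X k * K) *v v (int k - 1))"
      using bdrs by (simp add: bdrs_iterates_def)
    ultimately show ?thesis
      using a_nz by (simp add: vec_eq_iff a_def cumulative_scaling_step)
  qed
  moreover have "b (int k) = c \<oslash> (transpose (K ^ (k + 1)) *v a (int k))" for k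
  proof -
    \<comment> \<open>Here the row factor of \<open>X k\<close> stays in the sum and merges with
      \<open>u (int k)\<close> into \<open>a (int k)\<close>; the column factor pulls out.\<close>
    have "a (int k) = a (int k - 1) * u (int k)"
      by (simp add: a_def cumulative_scaling_step)
    then have "(transpose (X k * K) *v u (int k)) $ j =
        b (int k - 1) $ j * (transpose (K ^ (k + 1)) *v a (int k)) $ j" for j
      by (simp add: matrix_vector_mult_def transpose_def X sum_distrib_left mult_ac)
    moreover have "v (int k) = c \<oslash> (transpose (X k * K) *v u (int k))"
      using bdrs by (simp add: bdrs_iterates_def)
    ultimately show ?thesis
      using b_nz by (simp add: vec_eq_iff b_def cumulative_scaling_step)
  qed
  ultimately show ?thesis
    by (simp add: decoupled_recursion_def cumulative_scaling_neg flip: a_def b_def)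
       (simp add: a_def b_def cumulative_scaling_neg)
qed

theorem proposition1:
  fixes r :: "real ^ 'm" and c :: "real ^ 'n"
    and C K :: "real ^ 'n ^ 'm" and \<eta> :: real
    and u a :: "int \<Rightarrow> real ^ 'm" and v b :: "int \<Rightarrow> real ^ 'n"
    and X :: "nat \<Rightarrow> real ^ 'n ^ 'm"
  assumes "\<forall>i. r $ i > 0" and "\<forall>j. c $ j > 0"
    and "(\<Sum>i\<in>UNIV. r $ i) = 1" and "(\<Sum>j\<in>UNIV. c $ j) = 1"
    and "\<eta> > 0" and "K = gibbs_kernel C \<eta>"
    and "bdrs_iterates r c K u v X"
    and "a = cumulative_scaling u" and "b = cumulative_scaling v"
  shows "decoupled_recursion r c K a b \<and>
    (\<forall>k. X (k + 1) = diag_mat (a (int k)) ** K ^ (k + 1) ** diag_mat (b (int k))) \<and>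
    (\<forall>a' b'. decoupled_recursion r c K a' b' \<longrightarrow>
      (\<forall>k. a' (int k) = a (int k) \<and> b' (int k) = b (int k) \<and>
           X (k + 1) = diag_mat (a' (int k)) ** K ^ (k + 1) ** diag_mat (b' (int k))))"
proof -
  have K: "0 < K $ i $ j" for i j
    using assms(6) by (simp add: gibbs_kernel_def)
  have dec: "decoupled_recursion r c K a b"
    using bdrs_decoupled[OF _ _ K assms(7)] assms(1,2,8,9) by simp
  have X: "X (k + 1) = diag_mat (a (int k)) ** K ^ (k + 1) ** diag_mat (b (int k))" for k
    \<comment> \<open>At \<open>k + 1\<close> the shifted index becomes
      \<open>int k\<close>.\<close>
    using bdrs_matrix_eq[OF assms(7), of "k + 1"] assms(8,9) by simp
  have "a' (int k) = a (int k) \<and> b' (int k) = b (int k)"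
    if "decoupled_recursion r c K a' b'" for a' b' k
    using decoupled_recursion_unique[OF dec that] by blast
  with dec X show ?thesis
    by metis
qed

end
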